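(* Let $D$ be a domain, let $M$ be a torsion-free $D$-module, and let $R=D\ltimes M$. If $J$ is an ideal of $R$ whose projection onto $D$, namely $\{d\in D:(d,m)\in J\text{ for some }m\in M\}$, is nonzero, then $\operatorname{Ann}_R(J)=0$. Consequently, $$\mathcal A^*(R)=\{0\ltimes N: N\text{ is a nonzero } D\text{-submodule of } M\}.$$
   Context: A domain is a commutative integral domain with identity. A $D$-module $M$ is torsion-free if $dx=0$ with $d\in D$, $x\in M$ implies $d=0$ or $x=0$. For a commutative ring $D$ and a $D$-module $M$, the idealization $D\ltimes M$ is the commutative ring whose additive group is $D\oplus M$ and whose multiplication is $(d,m)(d',m')=(dd',dm'+d'm)$. For a submodule $N$ of $M$, $0\ltimes N=\{(0,n):n\in N\}$. For a commutative ring $R$ with identity, $\operatorname{Ann}_R(I)=\{r\in R: rI=0\}$, and $\mathcal A^*(R)$ denotes the set of ideals $I$ of $R$ with $0\neq I\neq R$ and $\operatorname{Ann}_R(I)\neq 0$. *)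

theory Defs
  imports "HOL-Algebra.Module" "HOL-Algebra.Ideal"
begin

definition torsion_free :: "('a, 'c) ring_scheme \<Rightarrow> ('a, 'b, 'd) module_scheme \<Rightarrow> bool" where
  "torsion_free D M \<longleftrightarrow>
     (\<forall>d \<in> carrier D. \<forall>x \<in> carrier M. d \<odot>\<^bsub>M\<^esub> x = \<zero>\<^bsub>M\<^esub> \<longrightarrow> d = \<zero>\<^bsub>D\<^esub> \<or> x = \<zero>\<^bsub>M\<^esub>)"

text \<open>
  The library's module record extends the ring record, so \<open>M\<close> also carries multiplication and
  unit fields; the locale \<^locale>\<open>module\<close> leaves them unconstrained and they play no role here.
\<close>

definition idealization ::
    "('a, 'c) ring_scheme \<Rightarrow> ('a, 'b, 'd) module_scheme \<Rightarrow> ('a \<times> 'b) ring" where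
  "idealization D M =
     \<lparr>carrier = carrier D \<times> carrier M,
      mult = (\<lambda>(d, m) (d', m'). (d \<otimes>\<^bsub>D\<^esub> d', (d \<odot>\<^bsub>M\<^esub> m') \<oplus>\<^bsub>M\<^esub> (d' \<odot>\<^bsub>M\<^esub> m))),
      one = (\<one>\<^bsub>D\<^esub>, \<zero>\<^bsub>M\<^esub>),
      zero = (\<zero>\<^bsub>D\<^esub>, \<zero>\<^bsub>M\<^esub>),
      add = (\<lambda>(d, m) (d', m'). (d \<oplus>\<^bsub>D\<^esub> d', m \<oplus>\<^bsub>M\<^esub> m'))\<rparr>"

definition zero_idealization :: "('a, 'c) ring_scheme \<Rightarrow> 'b set \<Rightarrow> ('a \<times> 'b) set" where
  "zero_idealization D N = {(\<zero>\<^bsub>D\<^esub>, n) | n. n \<in> N}"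

definition Ann :: "('a, 'c) ring_scheme \<Rightarrow> 'a set \<Rightarrow> 'a set" where
  "Ann R I = {r \<in> carrier R. \<forall>x \<in> I. r \<otimes>\<^bsub>R\<^esub> x = \<zero>\<^bsub>R\<^esub>}"

definition annihilating_ideals :: "('a, 'c) ring_scheme \<Rightarrow> 'a set set" where
  "annihilating_ideals R =
     {I. ideal I R \<and> I \<noteq> {\<zero>\<^bsub>R\<^esub>} \<and> I \<noteq> carrier R \<and> Ann R I \<noteq> {\<zero>\<^bsub>R\<^esub>}}"

lemma (in module) idealization_cring: "cring (idealization R M)"
proof (rule cringI)
  show "abelian_group (idealization R M)"
  proof (rule abelian_groupI)
    fix x assume "x \<in> carrier (idealization R M)"
    then obtain d m where x: "x = (d, m)" "d \<in> carrier R" "m \<in> carrier M"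
      by (auto simp: idealization_def)
    show "\<exists>y\<in>carrier (idealization R M). y \<oplus>\<^bsub>idealization R M\<^esub> x = \<zero>\<^bsub>idealization R M\<^esub>"
      by (rule bexI[of _ "(\<ominus> d, \<ominus>\<^bsub>M\<^esub> m)"])
        (use x in \<open>auto simp: idealization_def R.l_neg M.l_neg\<close>)
  qed (auto simp: idealization_def R.add.m_ac M.add.m_ac)
  show "comm_monoid (idealization R M)"
    by (rule comm_monoidI)
      (auto simp: idealization_def R.m_ac M.add.m_ac
        smult_r_distr smult_assoc1[symmetric])
qed (auto simp: idealization_def R.l_distr R.r_distr smult_l_distr smult_r_distr M.add.m_ac R.m_ac smult_assoc1[symmetric])

end

theory Submission
  imports Defs
begin

text \<open>
  If \<open>(d, m) \<in> J\<close> with \<open>d \<noteq> 0\<close> and \<open>(a, b)\<close> annihilates \<open>J\<close>, then \<open>a d = 0\<close> forces \<open>a = 0\<close>, and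
  the second coordinate reduces to \<open>d b = 0\<close>, so \<open>b = 0\<close> by torsion-freeness. Hence an
  annihilating ideal lies in \<open>0 \<ltimes> M\<close>. Conversely, as \<open>(0 \<ltimes> M)\<^sup>2 = 0\<close>, every \<open>0 \<ltimes> N\<close> annihilates
  itself.
\<close>

context module
begin

lemma Ann_idealization_eq_zero:
  assumes "domain R" and "torsion_free R M" and "J \<subseteq> carrier (idealization R M)"
    and J: "(d, m) \<in> J" and d: "d \<noteq> \<zero>" and zero: "\<zero>\<^bsub>idealization R M\<^esub> \<in> Ann (idealization R M) J"
  shows "Ann (idealization R M) J = {\<zero>\<^bsub>idealization R M\<^esub>}"
proof -
  interpret domain R by fact
  have dm: "d \<in> carrier R" "m \<in> carrier M"
    using assms(3) J by (auto simp: idealization_def)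
  have "r = (\<zero>, \<zero>\<^bsub>M\<^esub>)" if r: "r \<in> Ann (idealization R M) J" for r
  proof -
    obtain a b where ab: "r = (a, b)" "a \<in> carrier R" "b \<in> carrier M"
      using r by (auto simp: Ann_def idealization_def)
    have "r \<otimes>\<^bsub>idealization R M\<^esub> (d, m) = \<zero>\<^bsub>idealization R M\<^esub>"
      using r J by (auto simp: Ann_def)
    then have ad: "a \<otimes> d = \<zero>"
      and sum: "a \<odot>\<^bsub>M\<^esub> m \<oplus>\<^bsub>M\<^esub> d \<odot>\<^bsub>M\<^esub> b = \<zero>\<^bsub>M\<^esub>"
      using ab by (auto simp: idealization_def)
    have a: "a = \<zero>"
      using ad ab dm d integral by blast
    with sum have "d \<odot>\<^bsub>M\<^esub> b = \<zero>\<^bsub>M\<^esub>"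
      using ab dm by simp
    then have "b = \<zero>\<^bsub>M\<^esub>"
      using assms(2) ab dm d by (auto simp: torsion_free_def)
    with a ab show ?thesis by simp
  qed
  \<comment> \<open>The argument so far puts the annihilator inside the zero ideal; the assumption
    \<open>zero\<close> gives the reverse inclusion.\<close>
  then show ?thesis
    using zero by (auto simp: idealization_def)
qed

text \<open>Since \<open>(a, b)\<close> times \<open>(\<zero>, n)\<close> is
  \<open>(\<zero>, a n)\<close> on either side, absorption of ring elements amounts to closure of
  \<open>N\<close> under scalars.\<close>

lemma ideal_zero_idealization:
  assumes "submodule N R M"
  shows "ideal (zero_idealization R N) (idealization R M)"
proof -
  interpret N: submodule N R M by fact
  interpret I: cring "idealization R M" by (rule idealization_cring)
  \<comment> \<open>A submodule is in particular a subgroup of the additive monoid of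
    \<open>M\<close>, so \<open>one_closed\<close> and \<open>m_closed\<close> speak of zero and
    addition.\<close>
  have N: "N \<subseteq> carrier M" "\<zero>\<^bsub>M\<^esub> \<in> N" "\<And>x y. x \<in> N \<Longrightarrow> y \<in> N \<Longrightarrow> x \<oplus>\<^bsub>M\<^esub> y \<in> N"
    using N.subset N.one_closed N.m_closed by auto
  show ?thesis
  proof (rule idealI)
    show "ring (idealization R M)" by (rule I.ring_axioms)
    show "subgroup (zero_idealization R N) (add_monoid (idealization R M))"
    proof (rule I.add.subgroupI)
      fix x assume "x \<in> zero_idealization R N"
      then obtain n where n: "x = (\<zero>, n)" "n \<in> N"
        by (auto simp: zero_idealization_def)
      have inv: "\<ominus>\<^bsub>M\<^esub> n \<in> N"
        using N.m_inv_closed[OF n(2)] by (simp add: a_inv_def)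
      \<comment> \<open>Negation in the idealization is not given by a formula; uniqueness of
        additive inverses identifies it with the coordinatewise negative.\<close>
      have "\<ominus>\<^bsub>idealization R M\<^esub> x = (\<zero>, \<ominus>\<^bsub>M\<^esub> n)"
        by (rule I.minus_equality)
          (use n inv subsetD[OF N(1)] in \<open>simp_all add: idealization_def M.l_neg\<close>)
      then show "\<ominus>\<^bsub>idealization R M\<^esub> x \<in> zero_idealization R N"
        using inv by (auto simp: zero_idealization_def)
    qed (use N in \<open>auto simp: zero_idealization_def idealization_def\<close>)
  qed (use N subsetD[OF N(1)] N.smult_closed in \<open>auto simp: zero_idealization_def idealization_def\<close>)
qed

text \<open>This recovers the candidate \<open>N\<close> from an annihilating ideal. Multiplying
  \<open>(\<zero>, n)\<close> by \<open>(a, \<zero>)\<close> yields \<open>(\<zero>, a n)\<close>,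
  so absorption in \<open>I\<close> becomes closure under scalars.\<close>

lemma submodule_of_ideal_idealization:
  assumes "ideal I (idealization R M)"
  shows "submodule {n. (\<zero>, n) \<in> I} R M" (is "submodule ?N R M")
proof -
  interpret I: ideal I "idealization R M" by fact
  have sub: "?N \<subseteq> carrier M"
    using I.a_subset by (auto simp: idealization_def)
  have smult: "a \<odot>\<^bsub>M\<^esub> n \<in> ?N" if "a \<in> carrier R" "n \<in> ?N" for a n
    using I.I_l_closed[of "(\<zero>, n)" "(a, \<zero>\<^bsub>M\<^esub>)"] that sub
    by (auto simp: idealization_def)
  show ?thesis
  proof (rule submoduleI)
    show "\<ominus>\<^bsub>M\<^esub> n \<in> ?N" if "n \<in> ?N" for n
      \<comment> \<open>The negative of \<open>n\<close> is its multiple by the scalar -1.\<close>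
      using smult[of "\<ominus> \<one>" n] that sub smult_l_minus[of \<one> n] by auto
    show "x \<oplus>\<^bsub>M\<^esub> y \<in> ?N" if "x \<in> ?N" "y \<in> ?N" for x y
      using additive_subgroup.a_closed[OF I.is_additive_subgroup, of "(\<zero>, x)" "(\<zero>, y)"] that
      by (auto simp: idealization_def)
    show "\<zero>\<^bsub>M\<^esub> \<in> ?N"
      using additive_subgroup.zero_closed[OF I.is_additive_subgroup] by (simp add: idealization_def)
  qed (use sub smult in auto)
qed

lemma zero_idealization_subset_Ann:
  assumes "N \<subseteq> carrier M"
  shows "zero_idealization R N \<subseteq> Ann (idealization R M) (zero_idealization R N)"
  using subsetD[OF assms] by (auto simp: Ann_def zero_idealization_def idealization_def)

end

theorem proposition2p3:
  fixes D :: "('a, 'c) ring_scheme" and M :: "('a, 'b, 'd) module_scheme"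
  assumes "domain D" and "module D M" and "torsion_free D M"
  shows "(\<forall>J. ideal J (idealization D M)
              \<and> {d \<in> carrier D. \<exists>m \<in> carrier M. (d, m) \<in> J} \<noteq> {\<zero>\<^bsub>D\<^esub>}
            \<longrightarrow> Ann (idealization D M) J = {\<zero>\<^bsub>idealization D M\<^esub>})
       \<and> annihilating_ideals (idealization D M)
           = {zero_idealization D N | N. submodule N D M \<and> N \<noteq> {\<zero>\<^bsub>M\<^esub>}}"
proof -
  let ?R = "idealization D M"
  interpret D: domain D by fact
  interpret module D M by fact
  interpret R: cring ?R by (rule idealization_cring)
  have Ann_zero: "Ann ?R J = {\<zero>\<^bsub>?R\<^esub>}"
    if J: "ideal J ?R" and proj: "{d \<in> carrier D. \<exists>m \<in> carrier M. (d, m) \<in> J} \<noteq> {\<zero>\<^bsub>D\<^esub>}" for J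
  proof -
    interpret J: ideal J ?R by fact
    \<comment> \<open>This puts 0 in the projection, so the projection is nonempty and differing
      from the zero set forces a nonzero element.\<close>
    have "(\<zero>\<^bsub>D\<^esub>, \<zero>\<^bsub>M\<^esub>) \<in> J"
      using additive_subgroup.zero_closed[OF J.is_additive_subgroup] by (simp add: idealization_def)
    then obtain d m where "(d, m) \<in> J" "d \<noteq> \<zero>\<^bsub>D\<^esub>"
      using proj by blast
    moreover have "\<zero>\<^bsub>?R\<^esub> \<in> Ann ?R J"
      using J.a_subset by (auto simp: Ann_def)
    ultimately show ?thesis
      using Ann_idealization_eq_zero[OF assms(1,3) J.a_subset] by blast
  qed
  have "annihilating_ideals ?R = {zero_idealization D N | N. submodule N D M \<and> N \<noteq> {\<zero>\<^bsub>M\<^esub>}}"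
    (is "_ = ?S")
  proof (intro equalityI subsetI)
    fix I assume "I \<in> annihilating_ideals ?R"
    then have I: "ideal I ?R" and nz: "I \<noteq> {\<zero>\<^bsub>?R\<^esub>}" and ann: "Ann ?R I \<noteq> {\<zero>\<^bsub>?R\<^esub>}"
      by (auto simp: annihilating_ideals_def)
    interpret I: ideal I ?R by fact
    have "{d \<in> carrier D. \<exists>m \<in> carrier M. (d, m) \<in> I} = {\<zero>\<^bsub>D\<^esub>}"
      using Ann_zero[OF I] ann by blast
    \<comment> \<open>All first coordinates in \<open>I\<close> vanish, so \<open>I\<close> is
      determined by its fibre over 0.\<close>
    then have eq: "I = zero_idealization D {n. (\<zero>\<^bsub>D\<^esub>, n) \<in> I}"
      using I.a_subset by (fastforce simp: zero_idealization_def idealization_def)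
    have "{n. (\<zero>\<^bsub>D\<^esub>, n) \<in> I} \<noteq> {\<zero>\<^bsub>M\<^esub>}"
    proof
      assume "{n. (\<zero>\<^bsub>D\<^esub>, n) \<in> I} = {\<zero>\<^bsub>M\<^esub>}"
      with eq have "I = zero_idealization D {\<zero>\<^bsub>M\<^esub>}" by simp
      with nz show False by (simp add: zero_idealization_def idealization_def)
    qed
    then show "I \<in> ?S"
      using eq submodule_of_ideal_idealization[OF I] by blast
  next
    fix I assume "I \<in> ?S"
    then obtain N where N: "I = zero_idealization D N" "submodule N D M" "N \<noteq> {\<zero>\<^bsub>M\<^esub>}"
      by blast
    interpret N: submodule N D M by fact
    \<comment> \<open>This \<open>n\<close> serves twice: \<open>(\<zero>, n)\<close> shows that
      \<open>I\<close> is nonzero and, as \<open>I\<close> annihilates itself, that its annihilator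
      is nonzero.\<close>
    obtain n where n: "n \<in> N" "n \<noteq> \<zero>\<^bsub>M\<^esub>"
      using N(3) N.one_closed by auto
    then have nI: "(\<zero>\<^bsub>D\<^esub>, n) \<in> I" "(\<zero>\<^bsub>D\<^esub>, n) \<noteq> \<zero>\<^bsub>?R\<^esub>"
      using N(1) by (auto simp: zero_idealization_def idealization_def)
    have "N \<subseteq> carrier M"
      using N.subset by simp
    then have "(\<zero>\<^bsub>D\<^esub>, n) \<in> Ann ?R I"
      using zero_idealization_subset_Ann nI N(1) by blast
    \<comment> \<open>The unit has first coordinate 1, which differs from 0 in a domain; hence
      \<open>I\<close> is proper.\<close>
    moreover have "\<one>\<^bsub>?R\<^esub> \<notin> I"
      using N(1) by (auto simp: zero_idealization_def idealization_def)
    moreover have "ideal I ?R"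
      using ideal_zero_idealization N by simp
    ultimately show "I \<in> annihilating_ideals ?R"
      using nI R.one_closed unfolding annihilating_ideals_def by blast
  qed
  with Ann_zero show ?thesis by blast
qed

end
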